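(* Let $q$ be a prime power, let $G$ be a finite chordal graph with a perfect elimination ordering $(v_1,\dots,v_\ell)$, and let $(x_1,\dots,x_\ell)$ be the corresponding coordinates on $\mathbb{F}_q^\ell$. Let $$\theta_k=\sum_{i\in C_{\ge k}}\frac{\Delta_q(E_{<k},x_i)}{\Delta_q(E_{<k})}\,\partial_i\qquad(1\le k\le \ell).$$ Then $\{\theta_1,\dots,\theta_\ell\}$ forms a basis for $D(\mathcal{A}_G^q)$ as a module over $\mathbb{F}_q[x_1,\dots,x_\ell]$.
   Context: $\mathbb{F}_q$ is the field with $q$ elements, $\partial_i=\partial/\partial x_i$. A graph is chordal if it has no induced cycle of length at least $4$. A vertex is simplicial if its set of neighbours is a clique. An ordering $(v_1,\dots,v_\ell)$ of the vertices of $G$ is a perfect elimination ordering if $v_i$ is simplicial in the subgraph of $G$ induced by $\{v_1,\dots,v_i\}$ for each $i\in[\ell]=\{1,\dots,\ell\}$. The $q$-deformation of the graphical arrangement is the arrangement of hyperplanes in $\mathbb{F}_q^\ell$ $$\mathcal{A}_G^q=\bigcup_{\{v_{i_1},\dots,v_{i_r}\}}\Big\{\{a_{i_1}x_{i_1}+\dots+a_{i_r}x_{i_r}=0\}\ \Big|\ (a_{i_1},\dots,a_{i_r})\in\mathbb{F}_q^r\setminus\{0\}\Big\},$$ where $\{v_{i_1},\dots,v_{i_r}\}$ runs over all nonempty cliques of $G$ (sets of pairwise adjacent vertices, including single vertices). For an arrangement $\mathcal{A}=\{H_1,\dots,H_n\}$ in $\mathbb{F}_q^\ell$ with $H_j=\alpha_j^{-1}(0)$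 for linear forms $\alpha_j$, let $S=\mathbb{F}_q[x_1,\dots,x_\ell]$ and $D(\mathcal{A})=\{\theta=\sum_{i=1}^\ell f_i\partial_i\mid f_i\in S,\ \theta\alpha_j\in(\alpha_j)\text{ for }1\le j\le n\}$, an $S$-module. For $1\le k\le\ell$ define $C_{\ge k}=\{k\}\cup\{i\in[\ell]\mid$ there exists a path $v_kv_{j_1}\cdots v_{j_n}v_i$ in $G$ such that $k<j_1<\dots<j_n<i\}$ (with $n\ge 0$, so $n=0$ means that $v_kv_i$ is an edge with $k<i$), and $E_{<k}=\{j\in[\ell]\mid j<k\text{ and }\{v_j,v_k\}\in E_G\}$. $\Delta_q(y_1,\dots,y_m)$ denotes the determinant of the Moore matrix, $\Delta_q(y_1,\dots,y_m)=\det\big(y_a^{q^{b-1}}\big)_{1\le a,b\le m}$, with the empty determinant equal to $1$. When $E_{<k}=\{j_1,\dots,j_m\}$ with $j_1<\dots<j_m$, put $\Delta_q(E_{<k})=\Delta_q(x_{j_1},\dots,x_{j_m})$ and $\Delta_q(E_{<k},x_i)=\Delta_q(x_{j_1},\dots,x_{j_m},x_i)$. *)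

theory Defs
  imports
    "HOL-Library.Function_Algebras"
    "HOL-Library.Poly_Mapping"
    "Jordan_Normal_Form.Determinant"
begin

text \<open>
  The index set \<open>[\<ell>] = {1, \<dots>, \<ell>}\<close> is a finite linearly ordered type \<open>'n\<close> (so
  \<open>\<ell> = CARD('n)\<close>), and the field with \<open>q\<close> elements is a finite field type \<open>'f\<close>
  with \<open>CARD('f) = q\<close>.
\<close>

section \<open>Graphs\<close>

text \<open>A graph is given by a vertex set \<open>V\<close> and a set \<open>E\<close> of two-element edges.\<close>

definition simple_graph :: "'v set \<Rightarrow> 'v set set \<Rightarrow> bool" where
  "simple_graph V E \<longleftrightarrow> finite V \<and> (\<forall>e\<in>E. e \<subseteq> V \<and> card e = 2)"

definition clique :: "'v set \<Rightarrow> 'v set set \<Rightarrow> 'v set \<Rightarrow> bool" where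
  "clique V E K \<longleftrightarrow> K \<subseteq> V \<and> (\<forall>u\<in>K. \<forall>w\<in>K. u \<noteq> w \<longrightarrow> {u, w} \<in> E)"

text \<open>\<open>cs\<close> lists the vertices of an induced cycle in cyclic order: the only edges among
  them are those joining cyclically consecutive ones.\<close>

definition induced_cycle :: "'v set \<Rightarrow> 'v set set \<Rightarrow> 'v list \<Rightarrow> bool" where
  "induced_cycle V E cs \<longleftrightarrow> 3 \<le> length cs \<and> distinct cs \<and> set cs \<subseteq> V \<and>
     (\<forall>i j. i < j \<and> j < length cs \<longrightarrow>
        ({cs ! i, cs ! j} \<in> E \<longleftrightarrow> j = i + 1 \<or> (i = 0 \<and> j = length cs - 1)))"

definition chordal :: "'v set \<Rightarrow> 'v set set \<Rightarrow> bool" where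
  "chordal V E \<longleftrightarrow> \<not> (\<exists>cs. induced_cycle V E cs \<and> 4 \<le> length cs)"

definition induced_edges :: "'v set set \<Rightarrow> 'v set \<Rightarrow> 'v set set" where
  "induced_edges E W = {e \<in> E. e \<subseteq> W}"

definition simplicial :: "'v set \<Rightarrow> 'v set set \<Rightarrow> 'v \<Rightarrow> bool" where
  "simplicial V E u \<longleftrightarrow> u \<in> V \<and> clique V E {w \<in> V. {u, w} \<in> E}"

definition perfect_elimination_ordering ::
    "'v set \<Rightarrow> 'v set set \<Rightarrow> ('n::{finite, linorder} \<Rightarrow> 'v) \<Rightarrow> bool" where
  "perfect_elimination_ordering V E v \<longleftrightarrow> bij_betw v UNIV V \<and>
     (\<forall>i. simplicial (v ` {..i}) (induced_edges E (v ` {..i})) (v i))"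

definition C_ge :: "'v set set \<Rightarrow> ('n::{finite, linorder} \<Rightarrow> 'v) \<Rightarrow> 'n \<Rightarrow> 'n set" where
  "C_ge E v k = {k} \<union> {i. \<exists>js. sorted_wrt (<) (k # js @ [i]) \<and>
     successively (\<lambda>a b. {v a, v b} \<in> E) (k # js @ [i])}"

definition E_lt :: "'v set set \<Rightarrow> ('n::{finite, linorder} \<Rightarrow> 'v) \<Rightarrow> 'n \<Rightarrow> 'n set" where
  "E_lt E v k = {j. j < k \<and> {v j, v k} \<in> E}"

section \<open>Polynomials and derivations\<close>

text \<open>\<open>('n, 'f) mpoly\<close> is the polynomial ring over \<open>'f\<close> in the variables \<open>x\<^sub>i\<close>, \<open>i :: 'n\<close>:
  finitely supported maps from exponent vectors to coefficients, with convolution product.\<close>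

type_synonym ('n, 'f) mpoly = "('n \<Rightarrow>\<^sub>0 nat) \<Rightarrow>\<^sub>0 'f"

definition X :: "'n \<Rightarrow> ('n, 'f::comm_ring_1) mpoly" where
  "X i = Poly_Mapping.single (Poly_Mapping.single i 1) 1"

definition linear_form :: "('n::finite \<Rightarrow> 'f::comm_ring_1) \<Rightarrow> ('n, 'f) mpoly" where
  "linear_form a = (\<Sum>i\<in>UNIV. Poly_Mapping.single 0 (a i) * X i)"

definition pdiff :: "'n \<Rightarrow> ('n, 'f::comm_ring_1) mpoly \<Rightarrow> ('n, 'f) mpoly" where
  "pdiff i p = (\<Sum>m\<in>Poly_Mapping.keys p.
     Poly_Mapping.single (m - Poly_Mapping.single i 1)
       (of_nat (Poly_Mapping.lookup m i) * Poly_Mapping.lookup p m))"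

text \<open>A derivation \<open>\<Sum>\<^sub>i f\<^sub>i \<partial>\<^sub>i\<close> is represented by its coefficient family \<open>f\<close>;
  addition of families is pointwise.\<close>

type_synonym ('n, 'f) derivation = "'n \<Rightarrow> ('n, 'f) mpoly"

definition apply_der ::
    "('n::finite, 'f::comm_ring_1) derivation \<Rightarrow> ('n, 'f) mpoly \<Rightarrow> ('n, 'f) mpoly" where
  "apply_der f p = (\<Sum>i\<in>UNIV. f i * pdiff i p)"

definition scale_der ::
    "('n, 'f::comm_ring_1) mpoly \<Rightarrow> ('n, 'f) derivation \<Rightarrow> ('n, 'f) derivation" where
  "scale_der c f = (\<lambda>i. c * f i)"

global_interpretation der: Modules.module
  "scale_der :: ('n, 'f::comm_ring_1) mpoly \<Rightarrow> ('n, 'f) derivation \<Rightarrow> ('n, 'f) derivation"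
  by standard (auto simp: scale_der_def fun_eq_iff algebra_simps)

section \<open>Arrangements\<close>

definition zero_set :: "('n::finite \<Rightarrow> 'f::comm_ring_1) \<Rightarrow> ('n \<Rightarrow> 'f) set" where
  "zero_set a = {x. (\<Sum>i\<in>UNIV. a i * x i) = 0}"

text \<open>Linear forms with the same zero set are nonzero scalar multiples of each other over a field,
  so ranging over all forms \<open>a\<close> that define a hyperplane of the arrangement imposes the same
  condition as choosing one form per hyperplane.  Membership in the ideal \<open>(\<alpha>)\<close> is
  divisibility by \<open>\<alpha>\<close>.\<close>

definition log_derivations ::
    "('n::finite \<Rightarrow> 'f::field) set set \<Rightarrow> ('n, 'f) derivation set" where
  "log_derivations A = {\<theta>. \<forall>a. zero_set a \<in> A \<longrightarrow>
     linear_form a dvd apply_der \<theta> (linear_form a)}"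

definition q_graphical_arrangement ::
    "'v set \<Rightarrow> 'v set set \<Rightarrow> ('n::finite \<Rightarrow> 'v) \<Rightarrow> ('n \<Rightarrow> 'f::field) set set" where
  "q_graphical_arrangement V E v =
     (\<Union>I \<in> {I. I \<noteq> {} \<and> clique V E (v ` I)}.
        {{x. (\<Sum>i\<in>I. a i * x i) = 0} | a. \<exists>i\<in>I. a i \<noteq> 0})"

section \<open>Moore determinants and the basis\<close>

definition Moore_det :: "nat \<Rightarrow> 'a::comm_ring_1 list \<Rightarrow> 'a" where
  "Moore_det q ys = det (mat (length ys) (length ys) (\<lambda>(a, b). (ys ! a) ^ (q ^ b)))"

text \<open>The coefficient of \<open>\<partial>\<^sub>i\<close> in \<open>\<theta>\<^sub>k\<close>, a priori only a rational function.\<close>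

definition theta_coeff ::
    "nat \<Rightarrow> 'v set set \<Rightarrow> ('n::{finite, linorder} \<Rightarrow> 'v) \<Rightarrow> 'n \<Rightarrow> 'n \<Rightarrow> ('n, 'f::field) mpoly fract"
  where
  "theta_coeff q E v k i =
     (if i \<in> C_ge E v k
      then let xs = map X (sorted_list_of_set (E_lt E v k))
           in to_fract (Moore_det q (xs @ [X i])) / to_fract (Moore_det q xs)
      else 0)"

end

theory Submission
  imports Defs
begin

text \<open>
  Let \<open>L\<^sub>k(z)\<close> be the product of \<open>z - w\<close> over all \<open>w\<close> in the \<open>F\<^sub>q\<close>-span of the variables
  \<open>x\<^sub>j\<close>, \<open>j \<in> E\<^bsub><k\<^esub>\<close>.  The Moore determinant \<open>\<Delta>\<^sub>q(E\<^bsub><k\<^esub>, z)\<close>, expanded along its last row,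
  is a polynomial in \<open>z\<close> of degree \<open>q\<^sup>m\<close>, \<open>m = |E\<^bsub><k\<^esub>|\<close>, with leading coefficient
  \<open>\<Delta>\<^sub>q(E\<^bsub><k\<^esub>)\<close>, and it vanishes on the \<open>q\<^sup>m\<close> elements of that span because it is
  \<open>F\<^sub>q\<close>-linear in \<open>z\<close> and vanishes at every \<open>x\<^sub>j\<close>.  So the quotient of determinants in the
  definition of \<open>\<theta>\<^sub>k\<close> is the polynomial \<open>L\<^sub>k(x\<^sub>i)\<close> (lemma \<open>Moore_det_X_snoc\<close>), and \<open>L\<^sub>k\<close>
  is \<open>F\<^sub>q\<close>-linear on linear forms.

  Membership of \<open>\<theta>\<^sub>k\<close> in \<open>D(\<A>)\<close>: let \<open>\<alpha> = \<Sum> a\<^sub>i x\<^sub>i\<close> be supported on a clique \<open>I\<close> that meets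
  \<open>C\<^bsub>\<ge>k\<^esub>\<close>.  The perfect elimination ordering forces every element of \<open>I\<close> outside
  \<open>C\<^bsub>\<ge>k\<^esub>\<close> into \<open>E\<^bsub><k\<^esub>\<close> (lemma \<open>neighbour_of_C_ge_in_E_lt\<close>), where \<open>L\<^sub>k(x\<^sub>i) = 0\<close>.
  Hence restricting the sum to \<open>C\<^bsub>\<ge>k\<^esub>\<close> loses nothing, and \<open>\<theta>\<^sub>k \<alpha> = L\<^sub>k(\<alpha>)\<close>, which is
  divisible by \<open>\<alpha>\<close>.

  Since \<open>C\<^bsub>\<ge>k\<^esub>\<close> contains no index below \<open>k\<close>, the coefficient matrix of the \<open>\<theta>\<^sub>k\<close> is triangular
  with nonzero diagonal entries \<open>L\<^sub>k(x\<^sub>k)\<close>; this gives independence.  For generation, let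
  \<open>\<theta> = \<Sum> f\<^sub>i \<partial>\<^sub>i \<in> D(\<A>)\<close> have first nonzero coefficient \<open>f\<^sub>k\<close>.  As \<open>E\<^bsub><k\<^esub> \<union> {k}\<close> is a clique, each
  \<open>x\<^sub>k - w\<close> with \<open>w\<close> in the span above defines a hyperplane of the arrangement, and \<open>\<theta>\<close> maps this
  form to \<open>f\<^sub>k\<close>.  The forms \<open>x\<^sub>k - w\<close> are pairwise coprime primes, so \<open>L\<^sub>k(x\<^sub>k)\<close> divides \<open>f\<^sub>k\<close>
  (lemma \<open>basis_der_diag_dvd_leading_coeff\<close>), and subtracting a multiple of \<open>\<theta>\<^sub>k\<close> kills \<open>f\<^sub>k\<close>.
\<close>

section \<open>The Frobenius map over a finite field\<close>

text \<open>Multiplication by a nonzero \<open>a\<close> permutes the nonzero elements; compare their products.\<close>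

lemma power_card_field:
  fixes a :: "'f::{finite, field}"
  shows "a ^ card (UNIV :: 'f set) = a"
proof (cases "a = 0")
  case False
  have "a * (\<Prod>y\<in>UNIV-{0}. a * y) = a * a ^ (card (UNIV :: 'f set) - 1) * \<Prod>(UNIV-{0})"
    by (simp add: prod.distrib mult_ac)
  also have "a * a ^ (card (UNIV :: 'f set) - 1) = a ^ Suc (card (UNIV :: 'f set) - 1)"
    by (subst power_Suc) auto
  also have "Suc (card (UNIV :: 'f set) - 1) = card (UNIV :: 'f set)"
    using finite_UNIV_card_ge_0[where ?'a = 'f] by simp
  also have "(\<Prod>y\<in>UNIV-{0}. a * y) = (\<Prod>y\<in>UNIV-{0}. y)"
    by (rule prod.reindex_bij_witness[of _ "\<lambda>y. y / a" "\<lambda>y. a * y"]) (use False in auto)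
  finally show ?thesis
    by simp
qed (use finite_UNIV_card_ge_0[where ?'a = 'f] in auto)

lemma card_field_ge_2: "2 \<le> card (UNIV :: 'f::{finite, field} set)"
proof -
  have "card {0, 1 :: 'f} \<le> card (UNIV :: 'f set)"
    by (rule card_mono) auto
  then show ?thesis by simp
qed

text \<open>
  Additivity of the \<open>q\<close>-th power on the field itself says that \<open>(T + 1)\<^sup>q - T\<^sup>q - 1\<close> vanishes at
  all \<open>q\<close> field elements.  Its degree is below \<open>q\<close>, so its coefficients, the inner binomial
  coefficients, vanish in the field, hence in every algebra over it, where the binomial theorem then makes
  the \<open>q\<close>-th power additive.
\<close>

lemma binomial_card_field_eq_0:
  assumes "0 < i" "i < card (UNIV :: 'f::{finite, field} set)"
  shows "of_nat (card (UNIV :: 'f set) choose i) = (0 :: 'f)"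
proof -
  define q where "q = card (UNIV :: 'f set)"
  define p :: "'f poly" where "p = (\<Sum>j\<in>{0<..<q}. monom (of_nat (q choose j)) j)"
  have q: "2 \<le> q" unfolding q_def by (rule card_field_ge_2)
  have "poly p a = 0" for a
  proof -
    have "(a + 1) ^ q = (\<Sum>j\<le>q. of_nat (q choose j) * a ^ j)"
      by (subst binomial_ring) simp
    also have "{..q} = insert 0 (insert q {0<..<q})"
      using q by auto
    also have "(\<Sum>j\<in>insert 0 (insert q {0<..<q}). of_nat (q choose j) * a ^ j) = 1 + a ^ q + poly p a"
      using q by (simp add: p_def poly_sum poly_monom add_ac)
    finally show ?thesis
      by (simp add: q_def power_card_field)
  qed
  moreover have "degree p < q"
  proof -
    have "degree p \<le> q - 1"
      unfolding p_def by (rule degree_sum_le) (auto intro!: order.trans[OF degree_monom_le])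
    with q show ?thesis by simp
  qed
  ultimately have "p = 0"
    by (intro poly_eqI_degree[where A = UNIV]) (use q in \<open>auto simp: q_def\<close>)
  then have "poly.coeff p i = 0" by simp
  also have "poly.coeff p i = (\<Sum>j\<in>{0<..<q}. if j = i then of_nat (q choose j) else 0)"
    unfolding p_def by (simp add: coeff_sum)
  also have "\<dots> = of_nat (q choose i)"
    using assms by (simp add: q_def)
  finally show ?thesis by (simp add: q_def)
qed

abbreviation Const :: "'f::comm_ring_1 \<Rightarrow> ('n, 'f) mpoly" where
  "Const \<equiv> Poly_Mapping.single 0"

lemma Const_power: "Const (a :: 'f::comm_ring_1) ^ n = (Const (a ^ n) :: ('n, 'f) mpoly)"
  by (induction n) (simp_all add: mult_single)

lemma mpoly_add_power_card_field:
  fixes f g :: "('n, 'f::{finite, field}) mpoly"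
  shows "(f + g) ^ card (UNIV :: 'f set) = f ^ card (UNIV :: 'f set) + g ^ card (UNIV :: 'f set)"
proof -
  define q where "q = card (UNIV :: 'f set)"
  have q: "2 \<le> q" unfolding q_def by (rule card_field_ge_2)
  have zero: "(of_nat (q choose j) :: ('n, 'f) mpoly) = 0" if "j \<in> {0<..<q}" for j
    using binomial_card_field_eq_0[of j, where 'f = 'f] that
    by (simp add: q_def flip: single_of_nat)
  have "(f + g) ^ q = (\<Sum>j\<le>q. of_nat (q choose j) * f ^ j * g ^ (q - j))"
    by (rule binomial_ring)
  also have "{..q} = insert 0 (insert q {0<..<q})"
    using q by auto
  also have "(\<Sum>j\<in>insert 0 (insert q {0<..<q}). of_nat (q choose j) * f ^ j * g ^ (q - j)) = f ^ q + g ^ q"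
    using q by (simp add: zero)
  finally show ?thesis by (simp add: q_def)
qed

section \<open>Moore determinants\<close>

text \<open>
  The cofactors of the last row do not see that row, so its last entry is set to the dummy
  value \<open>0\<close> here.
\<close>

definition Moore_cofactor :: "nat \<Rightarrow> 'a::comm_ring_1 list \<Rightarrow> nat \<Rightarrow> 'a" where
  "Moore_cofactor q xs b =
     cofactor (mat (Suc (length xs)) (Suc (length xs)) (\<lambda>(a, b). ((xs @ [0]) ! a) ^ (q ^ b)))
       (length xs) b"

lemma Moore_det_snoc:
  "Moore_det q (xs @ [z]) = (\<Sum>b\<le>length xs. z ^ (q ^ b) * Moore_cofactor q xs b)"
proof -
  define m where "m = length xs"
  define A where "A y = mat (Suc m) (Suc m) (\<lambda>(a, b). ((xs @ [y]) ! a) ^ (q ^ b))" for y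
  have del: "mat_delete (A z) m b = mat_delete (A 0) m b" for b
    by (rule eq_matI) (auto simp: mat_delete_def A_def m_def nth_append)
  have "Moore_det q (xs @ [z]) = det (A z)"
    by (simp add: Moore_det_def A_def m_def)
  also have "\<dots> = (\<Sum>b<Suc m. A z $$ (m, b) * cofactor (A z) m b)"
    by (rule laplace_expansion_row) (auto simp: A_def)
  also have "\<dots> = (\<Sum>b\<le>m. z ^ (q ^ b) * Moore_cofactor q xs b)"
  proof (rule sum.cong)
    fix b assume "b \<in> {..m}"
    then have "A z $$ (m, b) = z ^ (q ^ b)"
      by (simp add: A_def m_def)
    moreover have "Moore_cofactor q xs b = cofactor (A 0) m b"
      by (simp add: Moore_cofactor_def A_def m_def)
    ultimately show "A z $$ (m, b) * cofactor (A z) m b = z ^ (q ^ b) * Moore_cofactor q xs b"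
      by (simp add: cofactor_def del)
  qed auto
  finally show ?thesis by (simp add: m_def)
qed

lemma Moore_cofactor_last: "Moore_cofactor q xs (length xs) = Moore_det q xs"
proof -
  define m where "m = length xs"
  have "mat_delete (mat (Suc m) (Suc m) (\<lambda>(a, b). ((xs @ [0]) ! a) ^ (q ^ b))) m m
      = mat m m (\<lambda>(a, b). (xs ! a) ^ (q ^ b))"
    by (rule eq_matI) (auto simp: mat_delete_def m_def nth_append)
  then show ?thesis
    by (simp add: Moore_cofactor_def cofactor_def Moore_det_def m_def)
qed

lemma Moore_det_snoc_mem:
  assumes "y \<in> set xs"
  shows "Moore_det q (xs @ [y]) = 0"
proof -
  obtain j where j: "j < length xs" "xs ! j = y"
    using assms by (auto simp: in_set_conv_nth)
  show ?thesis
    unfolding Moore_det_def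
    by (rule det_identical_rows[where n = "length (xs @ [y])" and i = j and j = "length xs"])
      (use j in \<open>auto simp: nth_append intro!: eq_vecI\<close>)
qed

text \<open>
  As polynomials in \<open>z\<close>, both sides have degree at most \<open>q\<^sup>m\<close>, where \<open>m\<close> is the length of
  \<open>xs\<close>, and the same coefficient at \<open>q\<^sup>m\<close>, and they agree on the \<open>q\<^sup>m\<close> points of \<open>W\<close>.
\<close>

lemma Moore_det_snoc_eq_prod:
  fixes xs :: "'a::idom list"
  assumes q: "2 \<le> q"
    and card: "card W = q ^ length xs"
    and zero: "\<And>w. w \<in> W \<Longrightarrow> Moore_det q (xs @ [w]) = 0"
  shows "Moore_det q (xs @ [z]) = Moore_det q xs * (\<Prod>w\<in>W. z - w)"
proof -
  define m where "m = length xs"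
  define P where "P = (\<Sum>b\<le>m. monom (Moore_cofactor q xs b) (q ^ b))"
  define R where "R = smult (Moore_det q xs) (\<Prod>w\<in>W. [:- w, 1:])"
  have poly_P: "poly P y = Moore_det q (xs @ [y])" for y
    by (simp add: P_def Moore_det_snoc poly_sum poly_monom m_def mult.commute)
  have poly_R: "poly R y = Moore_det q xs * (\<Prod>w\<in>W. y - w)" for y
    by (simp add: R_def poly_prod)
  have fin: "finite W"
    using card q by (metis card.infinite not_numeral_le_zero power_eq_0_iff)
  have deg_prod: "degree (\<Prod>w\<in>W. [:- w, 1:]) = q ^ m"
    by (subst degree_prod_eq_sum_degree) (auto simp: card m_def)
  \<comment> \<open>the \<open>q^m\<close> points of \<open>W\<close> only suffice because the coefficients at \<open>q^m\<close> agree\<close>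
  have "P = R"
  proof (rule poly_eqI_degree_lead_coeff[where n = "q ^ m" and A = W])
    have "poly.coeff P (q ^ m) = (\<Sum>b\<le>m. if b = m then Moore_cofactor q xs b else 0)"
      unfolding P_def by (simp add: coeff_sum) (use q in \<open>auto intro!: sum.cong\<close>)
    also have "\<dots> = Moore_det q xs"
      by (simp add: m_def Moore_cofactor_last)
    also have "\<dots> = poly.coeff R (q ^ m)"
      using deg_prod lead_coeff_prod[of "\<lambda>w. [:- w, 1:]" W] by (simp add: R_def)
    finally show "poly.coeff P (q ^ m) = poly.coeff R (q ^ m)" .
    show "q ^ m \<le> card W" by (simp add: card m_def)
    show "degree P \<le> q ^ m"
      unfolding P_def
      by (rule degree_sum_le)
        (use q in \<open>auto intro!: order.trans[OF degree_monom_le] power_increasing\<close>)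
    show "degree R \<le> q ^ m"
      unfolding R_def using degree_smult_le deg_prod by metis
    show "poly P y = poly R y" if "y \<in> W" for y
    proof -
      have "(\<Prod>w\<in>W. y - w) = 0"
        using fin that by (auto simp: prod_zero_iff)
      then show ?thesis using that by (simp add: poly_P poly_R zero)
    qed
  qed
  then show ?thesis using poly_P poly_R by metis
qed

text \<open>
  In the expansion along the last row, \<open>z\<close> enters only through the powers \<open>z^(q^b)\<close>, which are
  additive and commute with multiplication by constants fixed by the \<open>q\<close>-th power.
\<close>

lemma Moore_det_snoc_linear:
  fixes xs :: "'a::comm_ring_1 list"
  assumes add: "\<And>x y :: 'a. (x + y) ^ q = x ^ q + y ^ q"
    and q: "0 < q"
    and const: "\<And>i. i \<in> I \<Longrightarrow> c i ^ q = c i"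
  shows "Moore_det q (xs @ [\<Sum>i\<in>I. c i * y i]) = (\<Sum>i\<in>I. c i * Moore_det q (xs @ [y i]))"
proof -
  have add_b: "(x + y) ^ (q ^ b) = x ^ (q ^ b) + y ^ (q ^ b)" for x y :: 'a and b
    by (induction b) (simp_all add: power_mult add mult.commute[of q])
  have sum_b: "(\<Sum>i\<in>I. f i) ^ (q ^ b) = (\<Sum>i\<in>I. f i ^ (q ^ b))" for f :: "_ \<Rightarrow> 'a" and b
    by (induction I rule: infinite_finite_induct) (use q in \<open>auto simp: add_b power_0_left\<close>)
  have const_b: "c i ^ (q ^ b) = c i" if "i \<in> I" for i b
    by (induction b) (simp_all add: power_mult const[OF that])
  have "Moore_det q (xs @ [\<Sum>i\<in>I. c i * y i])
      = (\<Sum>b\<le>length xs. \<Sum>i\<in>I. c i * (y i ^ (q ^ b) * Moore_cofactor q xs b))"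
    unfolding Moore_det_snoc sum_b sum_distrib_right
    by (intro sum.cong refl) (simp add: power_mult_distrib const_b mult.assoc)
  also have "\<dots> = (\<Sum>i\<in>I. c i * Moore_det q (xs @ [y i]))"
    unfolding Moore_det_snoc sum_distrib_left by (rule sum.swap)
  finally show ?thesis .
qed

section \<open>Linear forms\<close>

lemma linear_form_monomials:
  "linear_form a = (\<Sum>i\<in>UNIV. Poly_Mapping.single (Poly_Mapping.single i 1) (a i))"
  by (simp add: linear_form_def X_def mult_single)

lemma single_unit_inject:
  "Poly_Mapping.single i (1::nat) = Poly_Mapping.single j 1 \<longleftrightarrow> i = j"
  by (metis lookup_single_eq lookup_single_not_eq one_neq_zero)

lemma lookup_linear_form:
  "Poly_Mapping.lookup (linear_form a) (Poly_Mapping.single i 1) = a i"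
proof -
  have "Poly_Mapping.lookup (linear_form a) (Poly_Mapping.single i 1)
      = (\<Sum>j\<in>UNIV. if j = i then a j else 0)"
    unfolding linear_form_monomials lookup_sum
    by (intro sum.cong refl) (simp add: lookup_single when_def single_unit_inject del: One_nat_def)
  then show ?thesis by simp
qed

lemma linear_form_inject: "linear_form a = linear_form b \<longleftrightarrow> a = b"
  using lookup_linear_form by (metis ext)

lemma linear_form_unit: "linear_form (\<lambda>i. if i = k then 1 else 0) = X k"
  by (simp add: linear_form_def if_distrib[of Const] if_distrib[of "\<lambda>x. x * _"] cong: if_cong)

lemma linear_form_diff: "linear_form (\<lambda>i. a i - b i) = linear_form a - linear_form b"
  by (simp add: linear_form_def single_diff left_diff_distrib sum_subtractf)

lemma apply_der_linear_form:
  "apply_der \<theta> (linear_form a) = (\<Sum>i\<in>UNIV. Const (a i) * \<theta> i)"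
proof -
  have keys: "Poly_Mapping.keys (linear_form a)
      = (\<lambda>j. Poly_Mapping.single j 1) ` {j. a j \<noteq> 0}"
  proof (intro equalityI subsetI)
    fix m assume "m \<in> Poly_Mapping.keys (linear_form a)"
    then have "(\<Sum>j\<in>UNIV. Poly_Mapping.lookup
        (Poly_Mapping.single (Poly_Mapping.single j (1::nat)) (a j)) m) \<noteq> 0"
      by (simp add: in_keys_iff linear_form_monomials lookup_sum)
    then obtain j where "Poly_Mapping.lookup
        (Poly_Mapping.single (Poly_Mapping.single j (1::nat)) (a j)) m \<noteq> 0"
      by (meson sum.not_neutral_contains_not_neutral)
    then show "m \<in> (\<lambda>j. Poly_Mapping.single j 1) ` {j. a j \<noteq> 0}"
      by (auto simp: lookup_single when_def split: if_splits)
  qed (auto simp: in_keys_iff lookup_linear_form simp del: One_nat_def)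
  have inj: "inj_on (\<lambda>j. Poly_Mapping.single j (1::nat)) B" for B
    by (simp add: inj_on_def single_unit_inject del: One_nat_def)
  have "pdiff i (linear_form a) = Const (a i)" for i
  proof -
    have "pdiff i (linear_form a) = (\<Sum>j\<in>{j. a j \<noteq> 0}.
        Poly_Mapping.single (Poly_Mapping.single j 1 - Poly_Mapping.single i 1)
          (of_nat (Poly_Mapping.lookup (Poly_Mapping.single j 1) i) * a j))"
      by (simp add: pdiff_def keys sum.reindex[OF inj] lookup_linear_form del: One_nat_def)
    also have "\<dots> = (\<Sum>j\<in>{j. a j \<noteq> 0}. if j = i then Const (a i) else 0)"
      by (intro sum.cong refl) (simp add: lookup_single when_def)
    finally show ?thesis by simp
  qed
  then show ?thesis by (simp add: apply_der_def mult.commute)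
qed


section \<open>Coordinate subspaces of linear forms\<close>

definition coord_span :: "'n::finite set \<Rightarrow> ('n, 'f::comm_ring_1) mpoly set" where
  "coord_span J = linear_form ` {c. \<forall>i. i \<notin> J \<longrightarrow> c i = 0}"

lemma finite_coord_span: "finite (coord_span J :: ('n::finite, 'f::{finite, comm_ring_1}) mpoly set)"
  unfolding coord_span_def by simp

lemma zero_in_coord_span: "0 \<in> coord_span J"
  unfolding coord_span_def by (rule image_eqI[of _ _ "\<lambda>_. 0"]) (simp_all add: linear_form_def)

lemma X_in_coord_span_iff: "X i \<in> coord_span J \<longleftrightarrow> i \<in> J"
  for i :: "'n::finite"
  unfolding coord_span_def
  by (auto simp: linear_form_inject simp flip: linear_form_unit)

lemma card_coord_span:
  "card (coord_span J :: ('n::finite, 'f::{finite, comm_ring_1}) mpoly set)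
    = card (UNIV :: 'f set) ^ card J"
proof -
  have "bij_betw (\<lambda>c. restrict c J) {c :: 'n \<Rightarrow> 'f. \<forall>i. i \<notin> J \<longrightarrow> c i = 0} (J \<rightarrow>\<^sub>E UNIV)"
    by (rule bij_betw_byWitness[where f' = "\<lambda>c i. if i \<in> J then c i else 0"])
      (auto simp: fun_eq_iff restrict_def PiE_def extensional_def)
  moreover have "inj_on linear_form B" for B :: "('n \<Rightarrow> 'f) set"
    by (auto simp: inj_on_def linear_form_inject)
  ultimately show ?thesis
    by (simp add: coord_span_def card_image bij_betw_same_card card_PiE)
qed

text \<open>For \<open>J = E\<^bsub><k\<^esub>\<close> this is the polynomial called \<open>L\<^sub>k\<close> in the comments.\<close>

definition coord_span_poly :: "'n::finite set \<Rightarrow> ('n, 'f::comm_ring_1) mpoly \<Rightarrow> ('n, 'f) mpoly"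
  where "coord_span_poly J z = (\<Prod>w\<in>coord_span J. z - w)"

lemma Moore_det_X_snoc_linear_form:
  fixes a :: "'n::finite \<Rightarrow> 'f::{finite, field}"
  assumes q: "q = card (UNIV :: 'f set)"
  shows "Moore_det q (xs @ [linear_form a]) = (\<Sum>i\<in>UNIV. Const (a i) * Moore_det q (xs @ [X i]))"
  unfolding linear_form_def
proof (rule Moore_det_snoc_linear)
  show "(x + y) ^ q = x ^ q + y ^ q" for x y :: "('n, 'f) mpoly"
    unfolding q by (rule mpoly_add_power_card_field)
  show "0 < q" using card_field_ge_2[where 'f = 'f] q by linarith
  show "Const (a i) ^ q = Const (a i)" for i
    by (simp add: Const_power q power_card_field)
qed

text \<open>
  The determinant vanishes at each variable \<open>x\<^sub>j\<close> with \<open>j\<close> in the list (two equal rows), hence by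
  linearity on their whole span, which has the \<open>q\<^sup>m\<close> elements that the product formula requires.
\<close>

lemma Moore_det_X_snoc:
  fixes z :: "('n::{finite, linorder}, 'f::{finite, field}) mpoly"
  assumes q: "q = card (UNIV :: 'f set)" and "distinct js"
  shows "Moore_det q (map X js @ [z]) = Moore_det q (map X js) * coord_span_poly (set js) z"
  unfolding coord_span_poly_def
proof (rule Moore_det_snoc_eq_prod)
  show "2 \<le> q" unfolding q by (rule card_field_ge_2)
  show "card (coord_span (set js) :: ('n, 'f) mpoly set) = q ^ length (map X js)"
    using assms by (simp add: card_coord_span distinct_card)
  fix w :: "('n, 'f) mpoly" assume "w \<in> coord_span (set js)"
  then obtain c where c: "w = linear_form c" "\<And>i. i \<notin> set js \<Longrightarrow> c i = 0"
    by (auto simp: coord_span_def)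
  have term_0: "Const (c i) * Moore_det q (map X js @ [X i]) = 0" for i
  proof (cases "i \<in> set js")
    case True
    then show ?thesis by (simp add: Moore_det_snoc_mem)
  qed (simp add: c(2))
  then show "Moore_det q (map X js @ [w]) = 0"
    unfolding c(1) Moore_det_X_snoc_linear_form[OF q] by (intro sum.neutral ballI term_0)
qed

text \<open>
  Appending a new variable \<open>x\<^sub>i\<close> to the list multiplies the determinant by factors \<open>x\<^sub>i - w\<close>, none
  of which vanishes because \<open>x\<^sub>i\<close> is not in the span of the earlier variables.
\<close>

lemma Moore_det_X_nonzero:
  assumes q: "q = card (UNIV :: 'f::{finite, field} set)" and "distinct js"
  shows "Moore_det q (map X js :: ('n::{finite, linorder}, 'f) mpoly list) \<noteq> 0"
  using \<open>distinct js\<close>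
proof (induction js rule: rev_induct)
  case (snoc i js)
  have "coord_span_poly (set js) (X i) \<noteq> (0 :: ('n, 'f) mpoly)"
  proof
    assume "coord_span_poly (set js) (X i) = (0 :: ('n, 'f) mpoly)"
    then have "\<exists>w\<in>coord_span (set js). X i - w = (0 :: ('n, 'f) mpoly)"
      by (simp add: coord_span_poly_def prod_zero_iff finite_coord_span)
    then have "X i \<in> (coord_span (set js) :: ('n, 'f) mpoly set)" by auto
    with snoc.prems show False by (simp add: X_in_coord_span_iff)
  qed
  with snoc show ?case by (simp add: Moore_det_X_snoc[OF q])
qed (simp add: Moore_det_def)

text \<open>
  Linearity is inherited from the last row of the Moore determinant, after cancelling the nonzero
  factor \<open>Moore_det q (map X js)\<close>.
\<close>

lemma coord_span_poly_linear_form: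
  fixes a :: "'n::{finite, linorder} \<Rightarrow> 'f::{finite, field}"
  shows "coord_span_poly J (linear_form a) = (\<Sum>i\<in>UNIV. Const (a i) * coord_span_poly J (X i))"
proof -
  define q where "q = card (UNIV :: 'f set)"
  obtain js where js: "distinct js" "set js = J"
    using finite_distinct_list[of J] by auto
  let ?M = "Moore_det q (map X js :: ('n, 'f) mpoly list)"
  have "?M * coord_span_poly J (linear_form a) = (\<Sum>i\<in>UNIV. Const (a i) * (?M * coord_span_poly J (X i)))"
    using Moore_det_X_snoc_linear_form[OF q_def, of "map X js" a]
    by (simp add: Moore_det_X_snoc[OF q_def js(1)] js(2))
  also have "\<dots> = ?M * (\<Sum>i\<in>UNIV. Const (a i) * coord_span_poly J (X i))"
    by (simp add: sum_distrib_left mult_ac)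
  finally show ?thesis
    using Moore_det_X_nonzero[OF q_def js(1)] by simp
qed

text \<open>The factor for \<open>w = 0\<close> is \<open>z\<close> itself.\<close>

lemma dvd_coord_span_poly:
  "z dvd coord_span_poly J (z :: ('n::finite, 'f::{finite, comm_ring_1}) mpoly)"
  unfolding coord_span_poly_def
  using dvd_prodI[OF finite_coord_span zero_in_coord_span, of "\<lambda>w. z - w"] by simp

lemma coord_span_poly_X_eq_0_iff:
  "coord_span_poly J (X i) = (0 :: ('n::{finite, linorder}, 'f::{finite, field}) mpoly) \<longleftrightarrow> i \<in> J"
proof -
  have "coord_span_poly J (X i) = (0 :: ('n, 'f) mpoly)
      \<longleftrightarrow> (\<exists>w\<in>coord_span J. X i = (w :: ('n, 'f) mpoly))"
    by (simp add: coord_span_poly_def prod_zero_iff finite_coord_span)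
  then show ?thesis by (simp add: X_in_coord_span_iff)
qed

section \<open>Substitution and divisibility by linear forms\<close>

text \<open>
  The substitution \<open>x\<^sub>k := u\<close> detects divisibility by \<open>x\<^sub>k - u\<close>: its values lie in an integral
  domain, and every polynomial is congruent to its image modulo \<open>x\<^sub>k - u\<close>.
\<close>

definition subst_mpoly :: "('n::finite \<Rightarrow> ('n, 'f::comm_ring_1) mpoly) \<Rightarrow> ('n, 'f) mpoly \<Rightarrow> ('n, 'f) mpoly"
  where "subst_mpoly \<rho> f = (\<Sum>m\<in>Poly_Mapping.keys f.
    Const (Poly_Mapping.lookup f m) * (\<Prod>i\<in>UNIV. \<rho> i ^ Poly_Mapping.lookup m i))"

lemma mpoly_sum_single:
  "f = (\<Sum>m\<in>Poly_Mapping.keys f. Poly_Mapping.single m (Poly_Mapping.lookup f m))"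
  by (rule poly_mapping_eqI)
    (simp add: lookup_sum lookup_single when_def in_keys_iff)

lemma mpoly_sum_monomial_induct [case_names monomial sum]:
  assumes "\<And>m a. P (Poly_Mapping.single m a)"
    and "\<And>f g. P f \<Longrightarrow> P g \<Longrightarrow> P (f + g)"
  shows "P (f :: ('n, 'f::comm_ring_1) mpoly)"
proof -
  have "P (\<Sum>m\<in>K. Poly_Mapping.single m (Poly_Mapping.lookup f m))" if "finite K" for K
    using that by (induction K) (use assms(1)[of 0 0] assms in auto)
  then show ?thesis using mpoly_sum_single[of f] by (metis finite_keys)
qed

lemma subst_mpoly_single:
  "subst_mpoly \<rho> (Poly_Mapping.single m a) = Const a * (\<Prod>i\<in>UNIV. \<rho> i ^ Poly_Mapping.lookup m i)"
  by (simp add: subst_mpoly_def)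

lemma subst_mpoly_add: "subst_mpoly \<rho> (f + g) = subst_mpoly \<rho> f + subst_mpoly \<rho> g"
  unfolding subst_mpoly_def
  by (rule setsum_keys_plus_distrib) (simp_all add: single_add distrib_right)

lemma subst_mpoly_0: "subst_mpoly \<rho> 0 = 0"
  by (simp add: subst_mpoly_def)

lemma subst_mpoly_1: "subst_mpoly \<rho> 1 = 1"
  using subst_mpoly_single[of \<rho> 0 1] by simp

lemma subst_mpoly_diff: "subst_mpoly \<rho> (f - g) = subst_mpoly \<rho> f - subst_mpoly \<rho> g"
  using subst_mpoly_add[of \<rho> "f - g" g] by (simp add: algebra_simps)

lemma subst_mpoly_mult:
  fixes f g :: "('n::finite, 'f::comm_ring_1) mpoly"
  shows "subst_mpoly \<rho> (f * g) = subst_mpoly \<rho> f * subst_mpoly \<rho> g"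
proof (induction f rule: mpoly_sum_monomial_induct)
  case (monomial m a)
  show ?case
  proof (induction g rule: mpoly_sum_monomial_induct)
    case (monomial n b)
    have Const_mult: "Const (a * b) = Const a * (Const b :: ('n, 'f) mpoly)"
      by (simp add: mult_single)
    show ?case
      unfolding mult_single subst_mpoly_single
      by (simp add: Const_mult lookup_add power_add prod.distrib mult_ac)
  qed (simp add: distrib_left subst_mpoly_add)
qed (simp add: distrib_right subst_mpoly_add)

lemma subst_mpoly_prod: "subst_mpoly \<rho> (\<Prod>w\<in>W. f w) = (\<Prod>w\<in>W. subst_mpoly \<rho> (f w))"
proof (induction W rule: infinite_finite_induct)
  case (insert w W)
  then show ?case by (simp add: subst_mpoly_mult)
qed (simp_all add: subst_mpoly_1)

lemma single_eq_Const_mult_prod_X: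
  "Poly_Mapping.single m a = Const a * (\<Prod>i\<in>UNIV. X i ^ Poly_Mapping.lookup m i)"
  for m :: "'n::finite \<Rightarrow>\<^sub>0 nat"
proof -
  have power: "X i ^ n = (Poly_Mapping.single (Poly_Mapping.single i n) 1 :: ('n, 'a) mpoly)" for i :: 'n and n
    by (induction n) (simp_all add: X_def mult_single flip: single_add)
  have prod: "(\<Prod>i\<in>I. Poly_Mapping.single (f i) 1) = (Poly_Mapping.single (sum f I) 1 :: ('n, 'a) mpoly)"
    for f and I :: "'n set"
    by (induction I rule: infinite_finite_induct) (simp_all add: mult_single)
  have "m = (\<Sum>i\<in>UNIV. Poly_Mapping.single i (Poly_Mapping.lookup m i))"
    by (rule poly_mapping_eqI) (simp add: lookup_sum lookup_single when_def)
  then show ?thesis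
    unfolding power prod by (simp add: mult_single)
qed

lemma dvd_mult_diff_mult:
  fixes d :: "'a::comm_ring_1"
  assumes "d dvd a - b" "d dvd x - y"
  shows "d dvd a * x - b * y"
proof -
  have "a * x - b * y = (a - b) * x + b * (x - y)"
    by (simp add: algebra_simps)
  then show ?thesis using assms by simp
qed

text \<open>Substituting congruent arguments into a polynomial gives congruent values.\<close>

lemma dvd_diff_subst_mpoly:
  assumes "\<And>i. d dvd X i - \<rho> i"
  shows "d dvd f - subst_mpoly \<rho> f"
proof (induction f rule: mpoly_sum_monomial_induct)
  case (monomial m a)
  have pow: "d dvd X i ^ n - \<rho> i ^ n" for i n
    by (induction n) (simp_all add: assms dvd_mult_diff_mult)
  have "d dvd (\<Prod>i\<in>I. X i ^ Poly_Mapping.lookup m i) - (\<Prod>i\<in>I. \<rho> i ^ Poly_Mapping.lookup m i)" for I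
    by (induction I rule: infinite_finite_induct) (simp_all add: pow dvd_mult_diff_mult)
  then show ?case
    unfolding subst_mpoly_single
    unfolding single_eq_Const_mult_prod_X[of m a] right_diff_distrib[symmetric]
    by (rule dvd_mult)
next
  case (sum f g)
  then show ?case
    unfolding subst_mpoly_add add_diff_add by (rule dvd_add)
qed

lemma subst_mpoly_X: "subst_mpoly \<rho> (X i) = \<rho> i"
proof -
  have "(\<Prod>j\<in>UNIV. \<rho> j ^ Poly_Mapping.lookup (Poly_Mapping.single i 1) j) = (\<Prod>j\<in>UNIV. if j = i then \<rho> i else 1)"
    by (rule prod.cong) (auto simp: lookup_single when_def)
  then show ?thesis by (simp add: X_def subst_mpoly_single)
qed

lemma subst_mpoly_linear_form: "subst_mpoly \<rho> (linear_form a) = (\<Sum>i\<in>UNIV. Const (a i) * \<rho> i)"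
proof -
  have "subst_mpoly \<rho> (\<Sum>i\<in>I. Const (a i) * X i) = (\<Sum>i\<in>I. Const (a i) * \<rho> i)" for I
    by (induction I rule: infinite_finite_induct)
      (simp_all add: subst_mpoly_0 subst_mpoly_add subst_mpoly_mult subst_mpoly_X subst_mpoly_single)
  then show ?thesis by (simp add: linear_form_def)
qed

lemma subst_mpoly_coord_span:
  assumes "w \<in> coord_span J" "k \<notin> J"
  shows "subst_mpoly (X(k := u)) w = w"
proof -
  obtain c where c: "w = linear_form c" "c k = 0"
    using assms by (auto simp: coord_span_def)
  then show ?thesis
    unfolding c(1) subst_mpoly_linear_form
    by (auto simp: linear_form_def intro!: sum.cong)
qed

text \<open>
  Split off the factors one by one.  If the product over \<open>W\<close> times \<open>g\<close> is divisible by \<open>x\<^sub>k - u\<close>,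
  then setting \<open>x\<^sub>k := u\<close> kills it; the factors \<open>x\<^sub>k - w\<close> become \<open>u - w \<noteq> 0\<close>, so \<open>g\<close> itself is
  killed and hence divisible by \<open>x\<^sub>k - u\<close>.  The assumption \<open>k \<notin> J\<close> keeps \<open>w\<close> fixed under the
  substitution.
\<close>

lemma prod_dvd_of_coord_span_roots:
  fixes f :: "('n::{finite, linorder}, 'f::field) mpoly"
  assumes "finite W" "W \<subseteq> coord_span J" "k \<notin> J"
    and "\<And>w. w \<in> W \<Longrightarrow> X k - w dvd f"
  shows "(\<Prod>w\<in>W. X k - w) dvd f"
  using assms
proof (induction W rule: finite_induct)
  case (insert u W)
  then obtain g where g: "f = (\<Prod>w\<in>W. X k - w) * g"
    by (auto elim: dvdE)
  let ?S = "subst_mpoly (X(k := u))"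
  have S: "?S (X k - w) = u - w" if "w \<in> insert u W" for w
    using subst_mpoly_coord_span[of w J k u] that insert.prems
    by (auto simp: subst_mpoly_diff subst_mpoly_X)
  obtain h where "f = (X k - u) * h"
    using insert.prems by (auto elim: dvdE)
  then have "?S f = 0"
    using S[of u] by (simp add: subst_mpoly_mult)
  moreover have "?S f = (\<Prod>w\<in>W. u - w) * ?S g"
    unfolding g by (simp add: subst_mpoly_mult subst_mpoly_prod S)
  moreover have "(\<Prod>w\<in>W. u - w) \<noteq> 0"
    using insert.hyps by (auto simp: prod_zero_iff)
  ultimately have "?S g = 0" by simp
  moreover have "X k - u dvd g - ?S g"
    by (rule dvd_diff_subst_mpoly) simp
  ultimately have "X k - u dvd g" by simp
  then show ?case
    using insert.hyps unfolding g by (simp add: mult.commute mult_dvd_mono)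
qed simp


section \<open>Perfect elimination orderings\<close>

lemma C_ge_ge: "i \<in> C_ge E v k \<Longrightarrow> k \<le> i"
  by (auto simp: C_ge_def)

lemma C_ge_step:
  assumes "i \<in> C_ge E v k" "i < j" "{v i, v j} \<in> E"
  shows "j \<in> C_ge E v k"
proof (cases "i = k")
  case True
  then show ?thesis
    using assms by (auto simp: C_ge_def intro!: exI[of _ "[]"])
next
  case False
  then obtain js where js: "sorted_wrt (<) (k # js @ [i])"
      "successively (\<lambda>a b. {v a, v b} \<in> E) (k # js @ [i])"
    using assms(1) by (auto simp: C_ge_def)
  have "sorted_wrt (<) ((k # js @ [i]) @ [j])"
    using js(1) assms(2) by (auto simp: sorted_wrt_append)
  moreover have "successively (\<lambda>a b. {v a, v b} \<in> E) ((k # js @ [i]) @ [j])"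
    using js(2) assms(3) unfolding successively_append_iff by simp
  ultimately show ?thesis
    unfolding C_ge_def by (intro UnI2 CollectI exI[of _ "js @ [i]"]) simp
qed

text \<open>
  The increasing paths from \<open>k\<close> are built up by appending vertices at the end; this is the
  induction that follows such a path.
\<close>

lemma C_ge_induct [consumes 1, case_names base step]:
  assumes "i \<in> C_ge E v k"
    and base: "P k"
    and step: "\<And>i j. i \<in> C_ge E v k \<Longrightarrow> i < j \<Longrightarrow> {v i, v j} \<in> E \<Longrightarrow> P i \<Longrightarrow> P j"
  shows "P i"
proof -
  have "i \<in> C_ge E v k \<and> P i"
    if "sorted_wrt (<) (k # js @ [i])" "successively (\<lambda>a b. {v a, v b} \<in> E) (k # js @ [i])" for js i
    using that
  proof (induction js arbitrary: i rule: rev_induct)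
    case Nil
    then show ?case
      using step[of k i] base C_ge_step[of k E v k i] by (auto simp: C_ge_def)
  next
    case (snoc j js)
    have sorted: "sorted_wrt (<) ((k # js @ [j]) @ [i])"
      and succ: "successively (\<lambda>a b. {v a, v b} \<in> E) ((k # js @ [j]) @ [i])"
      using snoc.prems by simp_all
    have "j \<in> C_ge E v k \<and> P j"
      by (rule snoc.IH)
        (use sorted succ in \<open>auto simp only: sorted_wrt_append successively_append_iff\<close>)
    moreover have "j < i"
      using sorted by (auto simp: sorted_wrt_append)
    moreover have "{v j, v i} \<in> E"
      using succ unfolding successively_append_iff by simp
    ultimately show ?case
      using step C_ge_step by blast
  qed
  with assms(1) base show ?thesis
    unfolding C_ge_def by blast
qed

lemma peo_earlier_neighbours_adjacent:
  assumes "perfect_elimination_ordering V E v"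
    and "i < k" "j < k" "{v i, v k} \<in> E" "{v j, v k} \<in> E" "i \<noteq> j"
  shows "{v i, v j} \<in> E"
proof -
  have bij: "bij_betw v UNIV V"
    and simp: "simplicial (v ` {..k}) (induced_edges E (v ` {..k})) (v k)"
    using assms(1) by (auto simp: perfect_elimination_ordering_def)
  have "v i \<noteq> v j"
    using bij assms(6) by (auto simp: bij_betw_def inj_eq)
  moreover have "{v k, v i} \<in> induced_edges E (v ` {..k})" "{v k, v j} \<in> induced_edges E (v ` {..k})"
    using assms by (auto simp: induced_edges_def insert_commute)
  ultimately have "{v i, v j} \<in> induced_edges E (v ` {..k})"
    using simp assms(2,3) by (auto simp: simplicial_def clique_def)
  then show ?thesis by (simp add: induced_edges_def)
qed

lemma clique_insert_E_lt:
  assumes "perfect_elimination_ordering V E v"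
  shows "clique V E (v ` insert k (E_lt E v k))"
proof -
  have "v ` UNIV = V"
    using assms by (auto simp: perfect_elimination_ordering_def bij_betw_def)
  then show ?thesis
    using peo_earlier_neighbours_adjacent[OF assms, of _ k]
    by (auto simp: clique_def E_lt_def insert_commute)
qed

text \<open>
  Follow the increasing path from \<open>i\<close> back to \<open>k\<close>.  The vertex \<open>j\<close> must precede \<open>i\<close>, or else the
  path could be prolonged to \<open>j\<close>.  So \<open>j\<close> and the predecessor \<open>h\<close> of \<open>i\<close> on the path are both
  earlier neighbours of \<open>i\<close>, hence adjacent, and the argument repeats with \<open>h\<close> in place of \<open>i\<close>
  until it reaches \<open>k\<close>.
\<close>

lemma neighbour_of_C_ge_in_E_lt:
  assumes peo: "perfect_elimination_ordering V E v"
    and "i \<in> C_ge E v k" "j \<notin> C_ge E v k" "{v i, v j} \<in> E" "i \<noteq> j"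
  shows "j \<in> E_lt E v k"
  using assms(2,4,5)
proof (induction rule: C_ge_induct)
  case base
  have "k \<in> C_ge E v k" by (simp add: C_ge_def)
  with base assms(3) have "j < k"
    using C_ge_step[of k E v k j] by (metis linorder_neqE)
  with base show ?case by (simp add: E_lt_def insert_commute)
next
  case (step h i)
  have "i \<in> C_ge E v k"
    using step.hyps C_ge_step by blast
  with step.prems assms(3) have "j < i"
    using C_ge_step[of i E v k j] by (metis linorder_neqE)
  have "h \<noteq> j" using step.hyps(1) assms(3) by auto
  have "{v h, v j} \<in> E"
    by (rule peo_earlier_neighbours_adjacent[OF peo \<open>h < i\<close> \<open>j < i\<close>])
      (use step \<open>h \<noteq> j\<close> in \<open>auto simp: insert_commute\<close>)
  then show ?case using step.IH \<open>h \<noteq> j\<close> by blast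
qed

section \<open>The arrangement\<close>

text \<open>
  A form \<open>a\<close> may define a hyperplane of the arrangement without being literally the form \<open>b\<close> that
  was used to define it.  All that matters is its support: for \<open>i \<notin> I\<close> the \<open>i\<close>-th unit vector
  lies on the hyperplane, so \<open>a i = 0\<close>.
\<close>

lemma zero_set_in_arrangement_imp_clique:
  assumes "zero_set a \<in> q_graphical_arrangement V E v"
  obtains I where "clique V E (v ` I)" "\<And>i. i \<notin> I \<Longrightarrow> a i = 0"
proof -
  obtain I b where I: "clique V E (v ` I)" and zs: "zero_set a = {x. (\<Sum>i\<in>I. b i * x i) = 0}"
    using assms unfolding q_graphical_arrangement_def by blast
  have "a i = 0" if "i \<notin> I" for i
  proof -
    have "(\<lambda>j. if j = i then 1 else 0) \<in> {x. (\<Sum>j\<in>I. b j * x j) = 0}"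
      using that by (auto intro!: sum.neutral)
    then have "(\<Sum>j\<in>UNIV. a j * (if j = i then 1 else 0)) = 0"
      unfolding zs[symmetric] by (simp add: zero_set_def)
    then show ?thesis by (simp add: if_distrib[of "(*) _"] cong: if_cong)
  qed
  with I show ?thesis by (rule that)
qed

lemma zero_set_in_arrangementI:
  assumes "clique V E (v ` I)" "\<And>i. i \<notin> I \<Longrightarrow> a i = 0" "a k \<noteq> 0"
  shows "zero_set a \<in> q_graphical_arrangement V E v"
proof -
  have "k \<in> I" using assms by blast
  have "(\<Sum>i\<in>UNIV. a i * x i) = (\<Sum>i\<in>I. a i * x i)" for x
    using assms(2) by (intro sum.mono_neutral_right) auto
  then have "zero_set a = {x. (\<Sum>i\<in>I. a i * x i) = 0}"
    by (simp add: zero_set_def)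
  then show ?thesis
    unfolding q_graphical_arrangement_def
    using assms(1,3) \<open>k \<in> I\<close> by blast
qed

section \<open>The basis\<close>

definition basis_der :: "'v set set \<Rightarrow> ('n::{finite, linorder} \<Rightarrow> 'v) \<Rightarrow> 'n \<Rightarrow> ('n, 'f::field) derivation"
  where "basis_der E v k i = (if i \<in> C_ge E v k then coord_span_poly (E_lt E v k) (X i) else 0)"

lemma to_fract_basis_der:
  assumes "card (UNIV :: 'f::{finite, field} set) = q"
  shows "to_fract (basis_der E v k i :: ('n::{finite, linorder}, 'f) mpoly) = theta_coeff q E v k i"
proof -
  define js where "js = sorted_list_of_set (E_lt E v k)"
  have js: "distinct js" "set js = E_lt E v k"
    by (simp_all add: js_def)
  have "Moore_det q (map X js :: ('n, 'f) mpoly list) \<noteq> 0"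
    by (rule Moore_det_X_nonzero) (use assms js in auto)
  then show ?thesis
    using Moore_det_X_snoc[OF assms[symmetric] js(1), of "X i :: ('n, 'f) mpoly"]
    by (simp add: basis_der_def theta_coeff_def Let_def js(2) flip: js_def)
qed

lemma basis_der_below: "i < k \<Longrightarrow> basis_der E v k i = 0"
  using C_ge_ge[of i E v k] by (auto simp: basis_der_def)

lemma basis_der_diag: "basis_der E v k k = coord_span_poly (E_lt E v k) (X k)"
  by (simp add: basis_der_def C_ge_def)

lemma basis_der_diag_nonzero:
  "basis_der E v k k \<noteq> (0 :: ('n::{finite, linorder}, 'f::{finite, field}) mpoly)"
  by (simp add: basis_der_diag coord_span_poly_X_eq_0_iff E_lt_def)

text \<open>
  If the clique \<open>I\<close> carrying \<open>\<alpha>\<close> misses \<open>C\<^bsub>\<ge>k\<^esub>\<close>, then \<open>\<theta>\<^sub>k \<alpha> = 0\<close>.  Otherwise the indices in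
  \<open>I\<close> at which \<open>\<theta>\<^sub>k\<close> was cut off to \<open>0\<close> lie in \<open>E\<^bsub><k\<^esub>\<close>, where \<open>L\<^sub>k(x\<^sub>i)\<close> is \<open>0\<close> anyway, and
  linearity gives \<open>\<theta>\<^sub>k \<alpha> = L\<^sub>k(\<alpha>)\<close>.
\<close>

lemma basis_der_in_log_derivations:
  fixes v :: "'n::{finite, linorder} \<Rightarrow> 'v"
  assumes peo: "perfect_elimination_ordering V E v"
  shows "(basis_der E v k :: ('n, 'f::{finite, field}) derivation)
    \<in> log_derivations (q_graphical_arrangement V E v)"
  unfolding log_derivations_def
proof (intro CollectI allI impI)
  fix a :: "'n \<Rightarrow> 'f"
  assume "zero_set a \<in> q_graphical_arrangement V E v"
  then obtain I where I: "clique V E (v ` I)" and supp: "\<And>i. i \<notin> I \<Longrightarrow> a i = 0"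
    by (rule zero_set_in_arrangement_imp_clique) blast
  let ?L = "coord_span_poly (E_lt E v k) :: ('n, 'f) mpoly \<Rightarrow> _"
  have inj: "inj v"
    using peo by (auto simp: perfect_elimination_ordering_def bij_betw_def)
  show "linear_form a dvd apply_der (basis_der E v k) (linear_form a)"
  proof (cases "I \<inter> C_ge E v k = {}")
    case True
    then have "Const (a i) * basis_der E v k i = 0" for i
      by (cases "i \<in> I") (use True supp in \<open>auto simp: basis_der_def\<close>)
    then have "apply_der (basis_der E v k) (linear_form a) = 0"
      unfolding apply_der_linear_form by (intro sum.neutral ballI)
    then show ?thesis by simp
  next
    case False
    then obtain h where h: "h \<in> I" "h \<in> C_ge E v k" by blast
    have eq_L: "Const (a i) * basis_der E v k i = Const (a i) * ?L (X i)" for i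
    proof (cases "i \<in> C_ge E v k \<or> i \<notin> I")
      case True
      then show ?thesis using supp[of i] by (auto simp: basis_der_def)
    next
      case False
      then have "h \<noteq> i" using h by auto
      then have "{v h, v i} \<in> E"
        using I h(1) False inj by (auto simp: clique_def inj_eq)
      then have "i \<in> E_lt E v k"
        using neighbour_of_C_ge_in_E_lt[OF peo h(2)] False \<open>h \<noteq> i\<close> by blast
      with False show ?thesis
        by (simp add: basis_der_def coord_span_poly_X_eq_0_iff)
    qed
    have "apply_der (basis_der E v k) (linear_form a) = ?L (linear_form a)"
      unfolding apply_der_linear_form coord_span_poly_linear_form by (simp only: eq_L)
    then show ?thesis by (simp add: dvd_coord_span_poly)
  qed
qed

lemma subspace_log_derivations: "der.subspace (log_derivations A)"
proof (rule der.subspaceI)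
  show "0 \<in> log_derivations A"
    by (simp add: log_derivations_def apply_der_def)
next
  fix \<theta> \<eta> :: "('a, 'b) derivation"
  assume "\<theta> \<in> log_derivations A" "\<eta> \<in> log_derivations A"
  moreover have "apply_der (\<theta> + \<eta>) p = apply_der \<theta> p + apply_der \<eta> p" for p
    by (simp add: apply_der_def distrib_right sum.distrib)
  ultimately show "\<theta> + \<eta> \<in> log_derivations A"
    by (simp add: log_derivations_def)
next
  fix c and \<theta> :: "('a, 'b) derivation"
  assume "\<theta> \<in> log_derivations A"
  moreover have "apply_der (scale_der c \<theta>) p = c * apply_der \<theta> p" for p
    by (simp add: apply_der_def scale_der_def sum_distrib_left mult.assoc)
  ultimately show "scale_der c \<theta> \<in> log_derivations A"
    by (simp add: log_derivations_def)
qed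

text \<open>
  The forms \<open>x\<^sub>k - w\<close>, with \<open>w\<close> in the span of the \<open>x\<^sub>j\<close>, \<open>j \<in> E\<^bsub><k\<^esub>\<close>, belong to the arrangement,
  and \<open>\<theta>\<close> sends each of them to \<open>\<theta> k\<close> because its coefficients below \<open>k\<close> vanish.
\<close>

lemma basis_der_diag_dvd_leading_coeff:
  fixes v :: "'n::{finite, linorder} \<Rightarrow> 'v"
    and \<theta> :: "('n, 'f::{finite, field}) derivation"
  assumes peo: "perfect_elimination_ordering V E v"
    and log: "\<theta> \<in> log_derivations (q_graphical_arrangement V E v)"
    and below: "\<And>i. i < k \<Longrightarrow> \<theta> i = 0"
  shows "basis_der E v k k dvd \<theta> k"
  unfolding basis_der_diag coord_span_poly_def
proof (rule prod_dvd_of_coord_span_roots[OF finite_coord_span subset_refl])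
  show "k \<notin> E_lt E v k" by (simp add: E_lt_def)
  fix w :: "('n, 'f) mpoly" assume "w \<in> coord_span (E_lt E v k)"
  then obtain c where c: "w = linear_form c" "\<And>i. i \<notin> E_lt E v k \<Longrightarrow> c i = 0"
    by (auto simp: coord_span_def)
  define a where "a = (\<lambda>i. (if i = k then 1 else 0) - c i)"
  have ck: "c k = 0" using c(2)[of k] by (simp add: E_lt_def)
  have a: "linear_form a = X k - w"
    by (simp add: a_def c(1) linear_form_diff linear_form_unit)
  have "zero_set a \<in> q_graphical_arrangement V E v"
    by (rule zero_set_in_arrangementI[OF clique_insert_E_lt[OF peo, of k], of a k])
      (auto simp: a_def c(2) ck)
  then have "X k - w dvd apply_der \<theta> (linear_form a)"
    using log by (auto simp: log_derivations_def a simp flip: a)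
  also have "apply_der \<theta> (linear_form a) = (\<Sum>i\<in>UNIV. if i = k then \<theta> k else 0)"
    unfolding apply_der_linear_form
  proof (rule sum.cong)
    fix i
    show "Const (a i) * \<theta> i = (if i = k then \<theta> k else 0)"
    proof (cases "i \<in> E_lt E v k")
      case True
      then have "i < k" by (simp add: E_lt_def)
      then show ?thesis by (simp add: below)
    qed (simp add: a_def c(2))
  qed simp
  finally show "X k - w dvd \<theta> k" by simp
qed

text \<open>
  Gaussian elimination: the induction is on the number of indices at or after the first nonzero
  coefficient, which drops when a multiple of \<open>\<theta>\<^sub>k\<close> is subtracted to clear the coefficient at \<open>k\<close>.
\<close>

lemma log_derivations_subset_span:
  fixes v :: "'n::{finite, linorder} \<Rightarrow> 'v"
    and \<theta> :: "('n, 'f::{finite, field}) derivation"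
  assumes peo: "perfect_elimination_ordering V E v"
    and "\<theta> \<in> log_derivations (q_graphical_arrangement V E v)"
  shows "\<theta> \<in> der.span (range (basis_der E v))"
  using assms(2)
proof (induction "card {i. \<exists>j\<le>i. \<theta> j \<noteq> 0}" arbitrary: \<theta> rule: less_induct)
  case less
  show ?case
  proof (cases "\<theta> = 0")
    case True
    then show ?thesis by (simp add: der.span_zero)
  next
    case False
    define k where "k = Min {j. \<theta> j \<noteq> 0}"
    have ne: "{j. \<theta> j \<noteq> 0} \<noteq> {}" using False by (auto simp: fun_eq_iff)
    have k: "\<theta> k \<noteq> 0" using Min_in[OF _ ne] by (simp add: k_def)
    have below: "\<theta> i = 0" if "i < k" for i
    proof (rule ccontr)
      assume "\<theta> i \<noteq> 0"
      then have "k \<le> i" unfolding k_def by (intro Min_le) auto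
      with that show False by simp
    qed
    obtain h where h: "\<theta> k = h * basis_der E v k k"
      using basis_der_diag_dvd_leading_coeff[OF peo less.prems, of k] below
      by (metis dvdE mult.commute)
    define \<eta> where "\<eta> = \<theta> - scale_der h (basis_der E v k)"
    have zero: "\<eta> i = 0" if "i \<le> k" for i
      using that h by (cases "i = k") (auto simp: \<eta>_def scale_der_def below basis_der_below)
    have "{i. \<exists>j\<le>i. \<eta> j \<noteq> 0} \<subset> {i. \<exists>j\<le>i. \<theta> j \<noteq> 0}"
    proof
      show "{i. \<exists>j\<le>i. \<eta> j \<noteq> 0} \<subseteq> {i. \<exists>j\<le>i. \<theta> j \<noteq> 0}"
      proof clarify
        fix i j assume "j \<le> i" "\<eta> j \<noteq> 0"
        then have "k \<le> i" using zero[of j] by (meson le_cases order.trans)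
        then show "\<exists>j\<le>i. \<theta> j \<noteq> 0" using k by blast
      qed
      have "k \<notin> {i. \<exists>j\<le>i. \<eta> j \<noteq> 0}" using zero by auto
      then show "{i. \<exists>j\<le>i. \<eta> j \<noteq> 0} \<noteq> {i. \<exists>j\<le>i. \<theta> j \<noteq> 0}" using k by blast
    qed
    then have "card {i. \<exists>j\<le>i. \<eta> j \<noteq> 0} < card {i. \<exists>j\<le>i. \<theta> j \<noteq> 0}"
      by (intro psubset_card_mono) auto
    moreover have "\<eta> \<in> log_derivations (q_graphical_arrangement V E v)"
      unfolding \<eta>_def
      by (intro der.subspace_diff der.subspace_scale subspace_log_derivations less.prems
          basis_der_in_log_derivations peo)
    ultimately have "\<eta> \<in> der.span (range (basis_der E v))"
      by (rule less.hyps)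
    then have "\<eta> + scale_der h (basis_der E v k) \<in> der.span (range (basis_der E v))"
      by (rule der.span_add) (intro der.span_scale der.span_base rangeI)
    then show ?thesis by (simp add: \<eta>_def)
  qed
qed

lemma inj_basis_der:
  "inj (basis_der E v :: 'n::{finite, linorder} \<Rightarrow> ('n, 'f::{finite, field}) derivation)"
proof (rule linorder_injI)
  fix j k :: 'n assume "j < k"
  then show "basis_der E v j \<noteq> (basis_der E v k :: ('n, 'f) derivation)"
    using basis_der_below[of j k E v] basis_der_diag_nonzero[of E v j] by metis
qed

text \<open>
  In a vanishing combination, look at the smallest \<open>k\<close> with nonzero weight: by triangularity
  \<open>\<theta>\<^sub>k\<close> alone contributes to the coefficient of \<open>\<partial>\<^sub>k\<close>.
\<close>

lemma independent_basis_der: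
  "der.independent (range (basis_der E v :: 'n::{finite, linorder} \<Rightarrow> ('n, 'f::{finite, field}) derivation))"
proof -
  let ?\<theta> = "basis_der E v :: 'n \<Rightarrow> ('n, 'f) derivation"
  have "\<forall>w\<in>range ?\<theta>. u w = 0" if sum: "(\<Sum>w\<in>range ?\<theta>. scale_der (u w) w) = 0" for u
  proof (rule ccontr)
    assume "\<not> ?thesis"
    then have ne: "{j. u (?\<theta> j) \<noteq> 0} \<noteq> {}" by auto
    define k where "k = Min {j. u (?\<theta> j) \<noteq> 0}"
    have k: "u (?\<theta> k) \<noteq> 0" using Min_in[OF _ ne] by (simp add: k_def)
    have below: "u (?\<theta> i) = 0" if "i < k" for i
    proof (rule ccontr)
      assume "u (?\<theta> i) \<noteq> 0"
      then have "k \<le> i" unfolding k_def by (intro Min_le) auto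
      with that show False by simp
    qed
    have eval: "(\<Sum>j\<in>J. f j) i = (\<Sum>j\<in>J. f j i)" for f :: "'n \<Rightarrow> ('n, 'f) derivation" and J i
      by (induction J rule: infinite_finite_induct) simp_all
    have "(\<Sum>j\<in>UNIV. scale_der (u (?\<theta> j)) (?\<theta> j)) = 0"
      using sum by (simp add: sum.reindex[OF inj_basis_der])
    then have "(\<Sum>j\<in>UNIV. scale_der (u (?\<theta> j)) (?\<theta> j)) k = 0" by simp
    then have "(\<Sum>j\<in>UNIV. u (?\<theta> j) * ?\<theta> j k) = 0"
      by (simp add: eval scale_der_def)
    also have "(\<Sum>j\<in>UNIV. u (?\<theta> j) * ?\<theta> j k) = (\<Sum>j\<in>UNIV. if j = k then u (?\<theta> k) * ?\<theta> k k else 0)"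
    proof (rule sum.cong)
      fix j
      show "u (?\<theta> j) * ?\<theta> j k = (if j = k then u (?\<theta> k) * ?\<theta> k k else 0)"
        using below[of j] basis_der_below[of k j E v] by (cases j k rule: linorder_cases) auto
    qed simp
    finally show False using k basis_der_diag_nonzero[where 'f = 'f, of E v k] by simp
  qed
  then show ?thesis by (auto simp: der.dependent_finite)
qed

theorem theorem4p2:
  fixes q :: nat
    and V :: "'v set" and E :: "'v set set"
    and v :: "'n::{finite, linorder} \<Rightarrow> 'v"
  assumes "card (UNIV :: 'f::{finite, field} set) = q"
    and "simple_graph V E"
    and "chordal V E"
    and "perfect_elimination_ordering V E v"
  shows "\<exists>\<theta> :: 'n \<Rightarrow> ('n, 'f) derivation.
    (\<forall>k i. to_fract (\<theta> k i) = theta_coeff q E v k i) \<and>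
    inj \<theta> \<and>
    der.independent (range \<theta>) \<and>
    der.span (range \<theta>) = log_derivations (q_graphical_arrangement V E v)"
proof (intro exI[of _ "basis_der E v"] conjI allI)
  let ?\<theta> = "basis_der E v :: 'n \<Rightarrow> ('n, 'f) derivation"
  show "to_fract (?\<theta> k i) = theta_coeff q E v k i" for k i
    by (rule to_fract_basis_der[OF assms(1)])
  show "inj ?\<theta>" by (rule inj_basis_der)
  show "der.independent (range ?\<theta>)" by (rule independent_basis_der)
  show "der.span (range ?\<theta>) = log_derivations (q_graphical_arrangement V E v)"
  proof
    show "der.span (range ?\<theta>) \<subseteq> log_derivations (q_graphical_arrangement V E v)"
      using basis_der_in_log_derivations[OF assms(4)]
      by (intro der.span_minimal subspace_log_derivations) blast
    show "log_derivations (q_graphical_arrangement V E v) \<subseteq> der.span (range ?\<theta>)"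
      using log_derivations_subset_span[OF assms(4)] by blast
  qed
qed

end
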